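(* Let $n,r\ge 1$ be integers and let $F_1,F_2\subseteq [n]^r$ satisfy $|F_1|>n^{r-1}$ and $|F_2|\ge n^{r-1}$. Then the pair $(F_1,F_2)$ has a rainbow matching, i.e. there exist $e_1\in F_1$ and $e_2\in F_2$ with $e_1\cap e_2=\emptyset$.
   Context: $[n]^r$ denotes the complete $r$-partite $r$-uniform hypergraph with pairwise disjoint sides $V_1,\dots,V_r$, each of size $n$: its edges are the sets containing exactly one vertex from each $V_i$. (Equivalently, edges are $r$-tuples, and two edges are disjoint if they differ in every coordinate.) Subsets of $[n]^r$ are sets of edges. *)

theory Defs
  imports Main "HOL-Library.Disjoint_Sets"
begin

text \<open>An $r$-partition with all sides of size $n$. The sides $V_1,\ldots,V_r$ are arbitrary
  sets of vertices; values of \<open>V\<close> outside \<open>{1..r}\<close> are irrelevant. Finiteness is stated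
  separately because \<open>card\<close> is 0 on infinite sets.\<close>

definition balanced_sides :: "nat \<Rightarrow> nat \<Rightarrow> (nat \<Rightarrow> 'a set) \<Rightarrow> bool" where
  "balanced_sides n r V \<longleftrightarrow>
     disjoint_family_on V {1..r} \<and> (\<forall>i\<in>{1..r}. finite (V i) \<and> card (V i) = n)"

text \<open>The edge set of $[n]^r$ on the sides $V_1,\ldots,V_r$.\<close>

definition complete_partite :: "nat \<Rightarrow> (nat \<Rightarrow> 'a set) \<Rightarrow> 'a set set" where
  "complete_partite r V =
     {e. e \<subseteq> (\<Union>i\<in>{1..r}. V i) \<and> (\<forall>i\<in>{1..r}. \<exists>!v. v \<in> e \<inter> V i)}"

end

theory Submission imports Defs "HOL-Analysis.Analysis" begin

text \<open>The argument is spectral. Let \<open>T\<close> be the operator that sends a function \<open>f\<close> on the \<open>n\<^sup>r\<close>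
  edges to the function whose value at an edge is the sum of \<open>f\<close> over the edges disjoint from it.
  It is the \<open>r\<close>-fold tensor power of the adjacency operator of the complete graph on \<open>n\<close>
  vertices, so constants are multiplied by \<open>(n - 1)\<^sup>r\<close>, while for \<open>n \<ge> 2\<close> functions with
  sum zero grow in norm by a factor of at most \<open>(n - 1)\<^bsup>r - 1\<^esup>\<close>. Instead of computing
  eigenvalues, \<open>disjoint_edge_sum_norm_le\<close> obtains this gap by induction on \<open>r\<close>, cutting an edge
  function into its slices along the last side.

  If no edge of \<open>F1\<close> is disjoint from an edge of \<open>F2\<close>, then \<open>T\<close> maps the indicator of \<open>F1\<close> to a
  function vanishing on \<open>F2\<close>. The sum of that function is \<open>(n - 1)\<^sup>r |F1|\<close>
  (\<open>sum_disjoint_edge_sum\<close>), and it is carried by at most \<open>n\<^sup>r - n\<^bsup>r - 1\<^esup>\<close> edges, so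
  Cauchy--Schwarz forces it to have a large norm. The spectral gap bounds the norm from above, and
  the two bounds together give \<open>|F1| \<le> n\<^bsup>r - 1\<^esup>\<close>.\<close>

section \<open>Splitting off the last side\<close>

lemma balanced_sides_SucD:
  assumes "balanced_sides n (Suc r) V"
  shows "balanced_sides n r V" "finite (V (Suc r))" "card (V (Suc r)) = n"
    "(\<Union>i\<in>{1..r}. V i) \<inter> V (Suc r) = {}"
proof -
  have range: "{1..Suc r} = insert (Suc r) {1..r}" by auto
  have disj: "disjoint_family_on V {1..Suc r}"
    and sides: "\<forall>i\<in>{1..Suc r}. finite (V i) \<and> card (V i) = n"
    using assms unfolding balanced_sides_def by blast+
  show "balanced_sides n r V"
    unfolding balanced_sides_def
    using disjoint_family_on_mono[OF _ disj, of "{1..r}"] sides by (simp add: range)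
  show "finite (V (Suc r))" "card (V (Suc r)) = n" using sides by simp_all
  have "V i \<inter> V (Suc r) = {}" if "i \<in> {1..r}" for i
    using disjoint_family_onD[OF disj, of i "Suc r"] that by simp
  then show "(\<Union>i\<in>{1..r}. V i) \<inter> V (Suc r) = {}" by blast
qed

lemma complete_partite_last_vertex_notin:
  assumes "balanced_sides n (Suc r) V" "v \<in> V (Suc r)" "e \<in> complete_partite r V"
  shows "v \<notin> e"
  using balanced_sides_SucD(4)[OF assms(1)] assms(2,3)
  unfolding complete_partite_def by blast

text \<open>An edge meets the last side in exactly one vertex; removing that vertex leaves an edge on the
  remaining sides. This product decomposition drives every induction on \<open>r\<close>.\<close>

lemma complete_partite_Suc_bij:
  assumes bal: "balanced_sides n (Suc r) V"
  shows "bij_betw (\<lambda>(v, e). insert v e) (V (Suc r) \<times> complete_partite r V)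
           (complete_partite (Suc r) V)"
proof -
  let ?W = "V (Suc r)" and ?U = "\<Union>i\<in>{1..r}. V i"
  have disj: "?U \<inter> ?W = {}" by (rule balanced_sides_SucD(4)[OF bal])
  have range: "{1..Suc r} = insert (Suc r) {1..r}" by auto
  have mem_Suc: "e \<in> complete_partite (Suc r) V \<longleftrightarrow>
      e \<subseteq> ?U \<union> ?W \<and> (\<forall>i\<in>{1..r}. \<exists>!v. v \<in> e \<inter> V i) \<and> (\<exists>!v. v \<in> e \<inter> ?W)" for e
    unfolding complete_partite_def range by (simp add: Un_commute conj_commute)
  have mem: "e \<in> complete_partite r V \<longleftrightarrow>
      e \<subseteq> ?U \<and> (\<forall>i\<in>{1..r}. \<exists>!v. v \<in> e \<inter> V i)" for e
    unfolding complete_partite_def by simp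
  show ?thesis
  proof (rule bij_betw_byWitness[where f' = "\<lambda>e. (THE v. v \<in> e \<inter> ?W, e - ?W)"])
    show "\<forall>p\<in>?W \<times> complete_partite r V.
        (THE v. v \<in> (case p of (v, e) \<Rightarrow> insert v e) \<inter> ?W,
         (case p of (v, e) \<Rightarrow> insert v e) - ?W) = p"
    proof
      fix p assume "p \<in> ?W \<times> complete_partite r V"
      then obtain v e where p: "p = (v, e)" and v: "v \<in> ?W" and "e \<in> complete_partite r V"
        by blast
      then have "e \<inter> ?W = {}" using disj unfolding complete_partite_def by blast
      with v have "insert v e \<inter> ?W = {v}" "insert v e - ?W = e" by auto
      then show "(THE v. v \<in> (case p of (v, e) \<Rightarrow> insert v e) \<inter> ?W,
          (case p of (v, e) \<Rightarrow> insert v e) - ?W) = p"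
        unfolding p prod.case by simp
    qed
    show "\<forall>e\<in>complete_partite (Suc r) V.
        (\<lambda>(v, e). insert v e) (THE v. v \<in> e \<inter> ?W, e - ?W) = e"
    proof
      fix e assume "e \<in> complete_partite (Suc r) V"
      then have "\<exists>!v. v \<in> e \<inter> ?W" unfolding mem_Suc by blast
      then obtain v where v: "e \<inter> ?W = {v}" by blast
      then have "insert v (e - ?W) = e" by blast
      then show "(\<lambda>(v, e). insert v e) (THE v. v \<in> e \<inter> ?W, e - ?W) = e"
        unfolding v prod.case by simp
    qed
    show "(\<lambda>(v, e). insert v e) ` (?W \<times> complete_partite r V) \<subseteq> complete_partite (Suc r) V"
    proof (rule image_subsetI)
      fix p assume "p \<in> ?W \<times> complete_partite r V"
      then obtain v e where p: "p = (v, e)" and v: "v \<in> ?W" and e: "e \<in> complete_partite r V"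
        by blast
      have eU: "e \<subseteq> ?U" using e unfolding complete_partite_def by blast
      have "insert v e \<inter> ?W = {v}" using v eU disj by blast
      moreover have "insert v e \<inter> V i = e \<inter> V i" if "i \<in> {1..r}" for i
        using that v disj by blast
      moreover have "insert v e \<subseteq> ?U \<union> ?W" using v eU by blast
      ultimately have "insert v e \<in> complete_partite (Suc r) V"
        using e unfolding mem mem_Suc by simp
      then show "(\<lambda>(v, e). insert v e) p \<in> complete_partite (Suc r) V" by (simp add: p)
    qed
    show "(\<lambda>e. (THE v. v \<in> e \<inter> ?W, e - ?W)) ` complete_partite (Suc r) V
        \<subseteq> ?W \<times> complete_partite r V"
    proof (rule image_subsetI)
      fix e assume e: "e \<in> complete_partite (Suc r) V"
      then have "\<exists>!v. v \<in> e \<inter> ?W" unfolding mem_Suc by blast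
      then obtain v where v: "e \<inter> ?W = {v}" by blast
      have "v \<in> ?W" using v by blast
      have "(e - ?W) \<inter> V i = e \<inter> V i" if "i \<in> {1..r}" for i
        using that disj by blast
      moreover have "e - ?W \<subseteq> ?U" using e unfolding mem_Suc by blast
      ultimately have "e - ?W \<in> complete_partite r V"
        using e unfolding mem mem_Suc by simp
      then show "(THE v. v \<in> e \<inter> ?W, e - ?W) \<in> ?W \<times> complete_partite r V"
        unfolding v using \<open>v \<in> ?W\<close> by simp
    qed
  qed
qed

lemma complete_partite_0: "complete_partite 0 V = {{}}"
  unfolding complete_partite_def by auto

lemma finite_card_complete_partite:
  assumes "balanced_sides n r V"
  shows "finite (complete_partite r V) \<and> card (complete_partite r V) = n ^ r"
  using assms
proof (induction r)
  case 0
  show ?case by (simp add: complete_partite_0)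
next
  case (Suc r)
  note sides = balanced_sides_SucD[OF Suc.prems]
  show ?case
    using bij_betw_finite[OF complete_partite_Suc_bij[OF Suc.prems]]
      bij_betw_same_card[OF complete_partite_Suc_bij[OF Suc.prems]]
      Suc.IH[OF sides(1)] sides(2,3)
    by (simp add: card_cartesian_product)
qed

lemma sum_complete_partite_Suc:
  fixes f :: "'a set \<Rightarrow> 'b::comm_monoid_add"
  assumes "balanced_sides n (Suc r) V"
  shows "(\<Sum>e\<in>complete_partite (Suc r) V. f e)
       = (\<Sum>v\<in>V (Suc r). \<Sum>e\<in>complete_partite r V. f (insert v e))"
  using sum.reindex_bij_betw[OF complete_partite_Suc_bij[OF assms], of f]
  by (simp add: sum.cartesian_product case_prod_unfold)

section \<open>The disjointness operator\<close>

definition disjoint_edge_sum ::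
    "nat \<Rightarrow> (nat \<Rightarrow> 'a set) \<Rightarrow> ('a set \<Rightarrow> real) \<Rightarrow> 'a set \<Rightarrow> real" where
  "disjoint_edge_sum r V f e = (\<Sum>e'\<in>complete_partite r V. if e \<inter> e' = {} then f e' else 0)"

lemma disjoint_edge_sum_sum:
  "disjoint_edge_sum r V (\<lambda>e. \<Sum>v\<in>A. f v e) e = (\<Sum>v\<in>A. disjoint_edge_sum r V (f v) e)"
proof -
  have "disjoint_edge_sum r V (\<lambda>e. \<Sum>v\<in>A. f v e) e
      = (\<Sum>e'\<in>complete_partite r V. \<Sum>v\<in>A. if e \<inter> e' = {} then f v e' else 0)"
    unfolding disjoint_edge_sum_def by (intro sum.cong) auto
  then show ?thesis unfolding disjoint_edge_sum_def by (simp add: sum.swap[of _ A])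
qed

text \<open>Edges with last vertices \<open>v\<close> and \<open>w\<close> are disjoint exactly when \<open>v \<noteq> w\<close> and their remaining
  parts are disjoint. The slice of the image at \<open>v\<close> therefore collects all slices of \<open>f\<close> but the
  one at \<open>v\<close>, which is written as the total minus that slice. On the factor belonging to the last
  side, this is the all-ones matrix minus the identity.\<close>

lemma disjoint_edge_sum_insert:
  fixes f :: "'a set \<Rightarrow> real"
  assumes bal: "balanced_sides n (Suc r) V"
    and v: "v \<in> V (Suc r)" and e: "e \<in> complete_partite r V"
  shows "disjoint_edge_sum (Suc r) V f (insert v e)
       = disjoint_edge_sum r V (\<lambda>e. \<Sum>w\<in>V (Suc r). f (insert w e)) e
         - disjoint_edge_sum r V (\<lambda>e. f (insert v e)) e"
proof -
  let ?W = "V (Suc r)"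
  have fin: "finite ?W" by (rule balanced_sides_SucD(2)[OF bal])
  have notin: "w \<notin> e" "v \<notin> e'"
    if "w \<in> ?W" "e' \<in> complete_partite r V" for w e'
    using complete_partite_last_vertex_notin[OF bal v that(2)]
      complete_partite_last_vertex_notin[OF bal that(1) e] by auto
  have "disjoint_edge_sum (Suc r) V f (insert v e)
      = (\<Sum>w\<in>?W. \<Sum>e'\<in>complete_partite r V.
           if insert v e \<inter> insert w e' = {} then f (insert w e') else 0)"
    unfolding disjoint_edge_sum_def by (rule sum_complete_partite_Suc[OF bal])
  also have "\<dots> = (\<Sum>w\<in>?W. if w = v then 0 else disjoint_edge_sum r V (\<lambda>e. f (insert w e)) e)"
    unfolding disjoint_edge_sum_def
    by (intro sum.cong refl) (auto simp: notin intro!: sum.cong)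
  also have "\<dots> = (\<Sum>w\<in>?W - {v}. disjoint_edge_sum r V (\<lambda>e. f (insert w e)) e)"
    using fin v by (simp add: sum.remove[of ?W v])
  also have "\<dots> = (\<Sum>w\<in>?W. disjoint_edge_sum r V (\<lambda>e. f (insert w e)) e)
      - disjoint_edge_sum r V (\<lambda>e. f (insert v e)) e"
    using fin v by (simp add: sum.remove[of ?W v])
  finally show ?thesis by (simp add: disjoint_edge_sum_sum)
qed

text \<open>The disjointness graph on the edges is regular of degree \<open>(n - 1)\<^sup>r\<close>; here this is used
  only in summed form.\<close>

lemma sum_disjoint_edge_sum:
  assumes "balanced_sides n r V"
  shows "(\<Sum>e\<in>complete_partite r V. disjoint_edge_sum r V f e)
       = (real n - 1) ^ r * (\<Sum>e\<in>complete_partite r V. f e)"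
  using assms
proof (induction r arbitrary: f)
  case 0
  show ?case by (simp add: complete_partite_0 disjoint_edge_sum_def)
next
  case (Suc r)
  note sides = balanced_sides_SucD[OF Suc.prems]
  let ?E = "complete_partite r V" and ?W = "V (Suc r)"
  define g where "g v e = f (insert v e)" for v e
  have "(\<Sum>e\<in>complete_partite (Suc r) V. disjoint_edge_sum (Suc r) V f e)
      = (\<Sum>v\<in>?W. \<Sum>e\<in>?E. disjoint_edge_sum r V (\<lambda>e. \<Sum>w\<in>?W. g w e) e
                           - disjoint_edge_sum r V (g v) e)"
    unfolding sum_complete_partite_Suc[OF Suc.prems] g_def
    by (intro sum.cong refl) (rule disjoint_edge_sum_insert[OF Suc.prems])
  also have "\<dots> = real n * ((real n - 1) ^ r * (\<Sum>e\<in>?E. \<Sum>w\<in>?W. g w e))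
                 - (\<Sum>v\<in>?W. (real n - 1) ^ r * (\<Sum>e\<in>?E. g v e))"
    by (simp add: sum_subtractf Suc.IH[OF sides(1)] sides(3))
  also have "\<dots> = (real n - 1) ^ Suc r * (\<Sum>v\<in>?W. \<Sum>e\<in>?E. g v e)"
    by (simp add: sum_distrib_left[symmetric] sum.swap[of _ ?W] left_diff_distrib)
  finally show ?case by (simp add: sum_complete_partite_Suc[OF Suc.prems] g_def)
qed

section \<open>The spectral gap\<close>

lemma sum_squared_difference_from_total:
  fixes x :: "'b \<Rightarrow> real"
  shows "(\<Sum>v\<in>A. ((\<Sum>w\<in>A. x w) - x v)\<^sup>2)
       = (real (card A) - 2) * (\<Sum>w\<in>A. x w)\<^sup>2 + (\<Sum>v\<in>A. (x v)\<^sup>2)"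
  by (simp add: power2_diff sum_subtractf sum.distrib sum_distrib_left[symmetric]
      sum_distrib_right[symmetric] power2_eq_square algebra_simps)

lemma variance_identity:
  fixes f :: "'b \<Rightarrow> real"
  assumes "finite A" "A \<noteq> {}"
  shows "(\<Sum>x\<in>A. (f x - sum f A / card A)\<^sup>2) = (\<Sum>x\<in>A. (f x)\<^sup>2) - (sum f A)\<^sup>2 / card A"
proof -
  have c: "real (card A) \<noteq> 0" using assms by simp
  have "(\<Sum>x\<in>A. (f x - sum f A / card A)\<^sup>2)
      = (\<Sum>x\<in>A. (f x)\<^sup>2) - 2 * (sum f A / card A) * sum f A + card A * (sum f A / card A)\<^sup>2"
    by (simp add: power2_diff sum_subtractf sum.distrib sum_distrib_left sum_distrib_right
        sum_divide_distrib mult_ac)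
  with c show ?thesis by (simp add: power2_eq_square field_simps)
qed

text \<open>The unnormalised variance is the squared norm of the component orthogonal to the constants.
  That component is linear in the function, so the bound is Cauchy--Schwarz applied pointwise to
  the centred functions.\<close>

lemma variance_sum_le:
  fixes f :: "'c \<Rightarrow> 'b \<Rightarrow> real"
  assumes "finite A" "A \<noteq> {}"
  shows "(\<Sum>x\<in>A. (\<Sum>v\<in>B. f v x)\<^sup>2) - (\<Sum>v\<in>B. sum (f v) A)\<^sup>2 / card A
       \<le> card B * (\<Sum>v\<in>B. (\<Sum>x\<in>A. (f v x)\<^sup>2) - (sum (f v) A)\<^sup>2 / card A)"
proof -
  define h where "h v x = f v x - sum (f v) A / card A" for v x
  have "(\<Sum>x\<in>A. (\<Sum>v\<in>B. f v x)\<^sup>2) - (\<Sum>v\<in>B. sum (f v) A)\<^sup>2 / card A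
      = (\<Sum>x\<in>A. (\<Sum>v\<in>B. h v x)\<^sup>2)"
    using variance_identity[OF assms, of "\<lambda>x. \<Sum>v\<in>B. f v x"]
    by (simp add: h_def sum_subtractf sum_divide_distrib sum.swap[of _ A B])
  also have "\<dots> \<le> (\<Sum>x\<in>A. card B * (\<Sum>v\<in>B. (h v x)\<^sup>2))"
    by (intro sum_mono) (metis sum_squared_le_sum_of_squares mult.commute)
  also have "\<dots> = card B * (\<Sum>v\<in>B. \<Sum>x\<in>A. (h v x)\<^sup>2)"
    by (simp add: sum_distrib_left sum.swap[of _ A B])
  finally show ?thesis unfolding h_def variance_identity[OF assms] .
qed

text \<open>With \<open>k + 1 = n\<close>, this rewrites the two mean terms of the norm bound, which is stated so as to
  separate variance and mean, by means of \<open>k\<^sup>2 - 1 = (k - 1) (k + 1)\<close>.\<close>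

lemma combine_mean_terms:
  fixes k N x c :: real
  assumes "k + 1 \<noteq> 0"
  shows "c - x / ((k + 1) * N) + k\<^sup>2 * x / ((k + 1) * N) = c + (k - 1) * x / N"
proof -
  have "k\<^sup>2 * x / ((k + 1) * N) - x / ((k + 1) * N) = ((k + 1) * ((k - 1) * x)) / ((k + 1) * N)"
    by (simp add: diff_divide_distrib[symmetric] power2_eq_square algebra_simps)
  also have "\<dots> = (k - 1) * x / N" using assms by simp
  finally show ?thesis by simp
qed

text \<open>The right-hand side splits the squared norm of \<open>f\<close> into its variance and its mean part
  \<open>S\<^sup>2 / n\<^sup>r\<close>, where \<open>S\<close> is the sum of \<open>f\<close>: the operator expands the first by at most
  \<open>((n - 1)\<^bsup>r - 1\<^esup>)\<^sup>2\<close> and the second by \<open>((n - 1)\<^sup>r)\<^sup>2\<close>. Multiplying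
  through by \<open>(n - 1)\<^sup>2\<close> makes the formula meaningful, and trivial, for \<open>r = 0\<close>.

  In the induction step each slice of the image is the image of the total minus that of one slice,
  so the squared norm is \<open>n - 2\<close> times that of the image of the total plus the sum over the images
  of the slices. Since the variance of the total is at most \<open>n\<close> times the sum of the slice
  variances, these variances acquire the factor \<open>(n - 2) n + 1 = (n - 1)\<^sup>2\<close>. The mean parts then
  match exactly: the spread of the slice sums is part of the variance of \<open>f\<close>. The hypothesis
  \<open>n \<ge> 2\<close> keeps the coefficient \<open>n - 2\<close> nonnegative.\<close>

lemma disjoint_edge_sum_norm_le:
  fixes f :: "'a set \<Rightarrow> real"
  assumes "balanced_sides n r V" and n: "n \<ge> 2"
  shows "(real n - 1)\<^sup>2 * (\<Sum>e\<in>complete_partite r V. (disjoint_edge_sum r V f e)\<^sup>2)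
      \<le> ((real n - 1) ^ r)\<^sup>2 *
        ((\<Sum>e\<in>complete_partite r V. (f e)\<^sup>2)
          - (\<Sum>e\<in>complete_partite r V. f e)\<^sup>2 / real n ^ r
          + (real n - 1)\<^sup>2 * (\<Sum>e\<in>complete_partite r V. f e)\<^sup>2 / real n ^ r)"
  using assms(1)
proof (induction r arbitrary: f)
  case 0
  show ?case by (simp add: complete_partite_0 disjoint_edge_sum_def)
next
  case (Suc r)
  note sides = balanced_sides_SucD[OF Suc.prems]
  let ?E = "complete_partite r V" and ?W = "V (Suc r)"
  define N where "N = real n ^ r"
  define d where "d = (real n - 1) ^ r"
  define k where "k = real n - 1"
  define g where "g v e = f (insert v e)" for v e
  define s where "s e = (\<Sum>v\<in>?W. g v e)" for e
  define S where "S = (\<Sum>v\<in>?W. sum (g v) ?E)"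
  define R where "R = (\<Sum>v\<in>?W. (sum (g v) ?E)\<^sup>2)"
  define Q where "Q = (\<Sum>v\<in>?W. \<Sum>e\<in>?E. (g v e)\<^sup>2)"
  have k: "real n = k + 1" "k \<ge> 1" using n by (auto simp: k_def)
  have N: "N > 0" using n by (simp add: N_def)
  have E: "finite ?E" "real (card ?E) = N"
    using finite_card_complete_partite[OF sides(1)] by (auto simp: N_def)
  then have E_ne: "?E \<noteq> {}" using N by auto
  have sum_s: "sum s ?E = S" unfolding s_def S_def by (rule sum.swap)
  let ?T = "disjoint_edge_sum r V"
  have Tf: "(\<Sum>e\<in>complete_partite (Suc r) V. (disjoint_edge_sum (Suc r) V f e)\<^sup>2)
      = (k - 1) * (\<Sum>e\<in>?E. (?T s e)\<^sup>2) + (\<Sum>v\<in>?W. \<Sum>e\<in>?E. (?T (g v) e)\<^sup>2)"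
  proof -
    have "(\<Sum>e\<in>complete_partite (Suc r) V. (disjoint_edge_sum (Suc r) V f e)\<^sup>2)
        = (\<Sum>v\<in>?W. \<Sum>e\<in>?E. ((\<Sum>w\<in>?W. ?T (g w) e) - ?T (g v) e)\<^sup>2)"
      unfolding sum_complete_partite_Suc[OF Suc.prems] g_def disjoint_edge_sum_sum[symmetric]
      by (intro sum.cong refl) (simp add: disjoint_edge_sum_insert[OF Suc.prems])
    also have "\<dots> = (\<Sum>e\<in>?E. (real (card ?W) - 2) * (\<Sum>w\<in>?W. ?T (g w) e)\<^sup>2
                         + (\<Sum>v\<in>?W. (?T (g v) e)\<^sup>2))"
      by (subst sum.swap) (simp add: sum_squared_difference_from_total)
    also have "\<dots> = (k - 1) * (\<Sum>e\<in>?E. (?T s e)\<^sup>2) + (\<Sum>e\<in>?E. \<Sum>v\<in>?W. (?T (g v) e)\<^sup>2)"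
      by (simp add: sum.distrib sum_distrib_left[symmetric] sides(3) k s_def[abs_def]
          disjoint_edge_sum_sum)
    also have "(\<Sum>e\<in>?E. \<Sum>v\<in>?W. (?T (g v) e)\<^sup>2) = (\<Sum>v\<in>?W. \<Sum>e\<in>?E. (?T (g v) e)\<^sup>2)"
      by (rule sum.swap)
    finally show ?thesis .
  qed
  have IH_s: "k\<^sup>2 * (\<Sum>e\<in>?E. (?T s e)\<^sup>2)
      \<le> d\<^sup>2 * ((\<Sum>e\<in>?E. (s e)\<^sup>2) - S\<^sup>2 / N + k\<^sup>2 * S\<^sup>2 / N)"
    using Suc.IH[OF sides(1), of s] by (simp add: k_def d_def N_def sum_s)
  have var_s: "(\<Sum>e\<in>?E. (s e)\<^sup>2) - S\<^sup>2 / N \<le> (k + 1) * (Q - R / N)"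
    using variance_sum_le[OF E(1) E_ne, of g ?W]
    by (simp add: s_def S_def Q_def R_def E(2) sides(3) k sum_subtractf sum_divide_distrib)
  have "k\<^sup>2 * (\<Sum>v\<in>?W. \<Sum>e\<in>?E. (?T (g v) e)\<^sup>2)
      \<le> (\<Sum>v\<in>?W. d\<^sup>2 * ((\<Sum>e\<in>?E. (g v e)\<^sup>2) - (sum (g v) ?E)\<^sup>2 / N
                            + k\<^sup>2 * (sum (g v) ?E)\<^sup>2 / N))"
    unfolding k_def d_def N_def
    by (subst sum_distrib_left) (intro sum_mono Suc.IH[OF sides(1)])
  also have "\<dots> = d\<^sup>2 * (Q - R / N + k\<^sup>2 * R / N)"
    by (simp add: Q_def R_def sum.distrib sum_subtractf sum_distrib_left[symmetric]
        sum_divide_distrib[symmetric])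
  finally have IH_g: "k\<^sup>2 * (\<Sum>v\<in>?W. \<Sum>e\<in>?E. (?T (g v) e)\<^sup>2)
      \<le> d\<^sup>2 * (Q - R / N + k\<^sup>2 * R / N)" .
  have "k\<^sup>2 * (\<Sum>e\<in>?E. (?T s e)\<^sup>2) \<le> d\<^sup>2 * ((k + 1) * (Q - R / N) + k\<^sup>2 * S\<^sup>2 / N)"
    using IH_s var_s by (smt (verit) mult_left_mono zero_le_power2)
  then have "(k - 1) * (k\<^sup>2 * (\<Sum>e\<in>?E. (?T s e)\<^sup>2))
      \<le> (k - 1) * (d\<^sup>2 * ((k + 1) * (Q - R / N) + k\<^sup>2 * S\<^sup>2 / N))"
    using k(2) by (intro mult_left_mono) auto
  with IH_g have "k\<^sup>2 * ((k - 1) * (\<Sum>e\<in>?E. (?T s e)\<^sup>2) + (\<Sum>v\<in>?W. \<Sum>e\<in>?E. (?T (g v) e)\<^sup>2))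
      \<le> (k - 1) * (d\<^sup>2 * ((k + 1) * (Q - R / N) + k\<^sup>2 * S\<^sup>2 / N))
        + d\<^sup>2 * (Q - R / N + k\<^sup>2 * R / N)"
    by (simp add: algebra_simps)
  also have "\<dots> = (d * k)\<^sup>2 * (Q - S\<^sup>2 / ((k + 1) * N) + k\<^sup>2 * S\<^sup>2 / ((k + 1) * N))"
  proof -
    have mean: "Q - S\<^sup>2 / ((k + 1) * N) + k\<^sup>2 * S\<^sup>2 / ((k + 1) * N) = Q + (k - 1) * S\<^sup>2 / N"
      using k(2) by (intro combine_mean_terms) simp
    show ?thesis unfolding mean using N by (simp add: field_simps power2_eq_square)
  qed
  finally show ?case
    unfolding Tf
    by (simp add: sum_complete_partite_Suc[OF Suc.prems] k_def d_def N_def Q_def S_def g_def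
        mult.commute)
qed

section \<open>Cross-intersecting families\<close>

theorem corollary1p15:
  fixes n r :: nat and V :: "nat \<Rightarrow> 'a set" and F1 F2 :: "'a set set"
  assumes "n \<ge> 1" and "r \<ge> 1"
    and "balanced_sides n r V"
    and "F1 \<subseteq> complete_partite r V" and "F2 \<subseteq> complete_partite r V"
    and "card F1 > n ^ (r - 1)" and "card F2 \<ge> n ^ (r - 1)"
  shows "\<exists>e1\<in>F1. \<exists>e2\<in>F2. e1 \<inter> e2 = {}"
proof (rule ccontr)
  assume "\<not> ?thesis"
  then have cross: "e1 \<inter> e2 \<noteq> {}" if "e1 \<in> F1" "e2 \<in> F2" for e1 e2 using that by blast
  let ?E = "complete_partite r V"
  have E: "finite ?E" "card ?E = n ^ r"
    using finite_card_complete_partite[OF assms(3)] by auto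
  \<comment> \<open>For \<open>n = 1\<close> there is a single edge, too few for the strict bound on \<open>F1\<close>.\<close>
  have "card F1 \<le> n ^ r" using card_mono[OF E(1) assms(4)] E(2) by simp
  then have "n \<noteq> 1" using assms(6) by auto
  then have n: "n \<ge> 2" using assms(1) by simp
  define f :: "'a set \<Rightarrow> real" where "f e = (if e \<in> F1 then 1 else 0)" for e
  define T where "T = disjoint_edge_sum r V f"
  define k where "k = real n - 1"
  define a where "a = real (card F1)"
  define M where "M = real n ^ (r - 1)"
  have k: "k \<ge> 1" "real n = k + 1" using n by (auto simp: k_def)
  have N: "real n ^ r = (k + 1) * M" using assms(2) by (cases r) (auto simp: M_def k)
  have M: "M > 0" "a > M" using n assms(6) by (auto simp: M_def a_def simp flip: of_nat_power)
  have sum_f: "sum f ?E = a"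
    using E(1) assms(4) by (simp add: f_def a_def sum.If_cases Int_absorb1)
  have square_f: "(f e)\<^sup>2 = f e" for e by (simp add: f_def)
  have gap: "k\<^sup>2 * (\<Sum>e\<in>?E. (T e)\<^sup>2)
      \<le> (k ^ r)\<^sup>2 * (a - a\<^sup>2 / ((k + 1) * M) + k\<^sup>2 * a\<^sup>2 / ((k + 1) * M))"
    using disjoint_edge_sum_norm_le[OF assms(3) n, of f]
    unfolding square_f sum_f T_def[symmetric] k_def[symmetric] N .
  have T0: "T e = 0" if "e \<in> F2" for e
    unfolding T_def disjoint_edge_sum_def f_def using cross that
    by (intro sum.neutral) (auto simp: Int_commute)
  have "real (card (?E - F2)) = real n ^ r - real (card F2)"
    using E assms(5) card_mono[OF E(1) assms(5)]
    by (simp add: card_Diff_subset finite_subset of_nat_diff)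
  moreover have "real (card F2) \<ge> M"
    using assms(7) by (simp add: M_def flip: of_nat_power)
  ultimately have co: "real (card (?E - F2)) \<le> k * M"
    unfolding N by (simp add: algebra_simps)
  \<comment> \<open>Lower bound on the norm of \<open>T\<close>: a prescribed sum on a support of size at most \<open>k * M\<close>.\<close>
  have "k ^ r * a = (\<Sum>e\<in>?E. T e)"
    unfolding T_def k_def by (simp add: sum_disjoint_edge_sum[OF assms(3)] sum_f)
  also have "\<dots> = (\<Sum>e\<in>?E - F2. T e)"
    using E(1) T0 by (intro sum.mono_neutral_right) auto
  finally have "(k ^ r * a)\<^sup>2 = (\<Sum>e\<in>?E - F2. T e)\<^sup>2" by simp
  also have "\<dots> \<le> real (card (?E - F2)) * (\<Sum>e\<in>?E - F2. (T e)\<^sup>2)"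
    using sum_squared_le_sum_of_squares[of T "?E - F2"] by (simp add: mult.commute)
  also have "\<dots> \<le> k * M * (\<Sum>e\<in>?E. (T e)\<^sup>2)"
    using co k M E(1) by (intro mult_mono sum_mono2 sum_nonneg) auto
  finally have "k\<^sup>2 * (k ^ r * a)\<^sup>2 \<le> k * M * (k\<^sup>2 * (\<Sum>e\<in>?E. (T e)\<^sup>2))"
    by (subst mult.left_commute) (rule mult_left_mono, simp_all)
  also have "\<dots> \<le> k * M * ((k ^ r)\<^sup>2 * (a - a\<^sup>2 / ((k + 1) * M) + k\<^sup>2 * a\<^sup>2 / ((k + 1) * M)))"
    using gap by (rule mult_left_mono) (use k M in simp)
  also have "\<dots> = (k * a * (k ^ r)\<^sup>2) * (M + (k - 1) * a)"
  proof -
    have "a - a\<^sup>2 / ((k + 1) * M) + k\<^sup>2 * a\<^sup>2 / ((k + 1) * M) = a + (k - 1) * a\<^sup>2 / M"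
      using k by (intro combine_mean_terms) simp
    also have "\<dots> = a * (M + (k - 1) * a) / M"
      using M by (simp add: field_simps power2_eq_square)
    finally show ?thesis using M by simp
  qed
  finally have "(k * a * (k ^ r)\<^sup>2) * (k * a) \<le> (k * a * (k ^ r)\<^sup>2) * (M + (k - 1) * a)"
    by (simp add: power2_eq_square algebra_simps)
  moreover have "k * a * (k ^ r)\<^sup>2 > 0" using k M by simp
  ultimately have "k * a \<le> M + (k - 1) * a" by (simp only: mult_le_cancel_left_pos)
  then show False using M by (simp add: algebra_simps)
qed

end
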